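(* Let $X \subset \mathbb{R}\mathbb{P}^n$ be an irreducible nondegenerate real projective variety whose real points are Zariski dense. Let $r_0$ be the minimum typical rank with respect to $X$, and let $r_{\mathrm{max}}$ be the maximum value of rank with respect to $X$. Then $$r_{\mathrm{max}} \leq 2\, r_0.$$
   Context: Let $\hat{X} \subset \mathbb{R}^{n+1}$ be the (real) affine cone over $X \subset \mathbb{R}\mathbb{P}^n$. $X$ is nondegenerate if it is not contained in a hyperplane. "Real points are Zariski dense" means that $X$ is the Zariski closure of its set of real points (equivalently, $X$ has a smooth real point). For nonzero $v \in \mathbb{R}^{n+1}$, the rank of $v$ with respect to $X$ is the least $r$ such that $v = x_1 + \dotsb + x_r$ with all $x_i \in \hat X$ (real vectors). The maximum rank $r_{\mathrm{max}}$ is the maximum of this rank over all nonzero $v \in \mathbb{R}^{n+1}$. An integer $r$ is a typical rank with respect to $X$ if the set of vectors in $\mathbb{R}^{n+1}$ whose rank equals $r$ contains a nonempty open subset of $\mathbb{R}^{n+1}$ in the Euclidean topology. *)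

theory Defs
  imports "HOL-Analysis.Analysis" "HOL-Library.Poly_Mapping" "HOL-Library.Extended_Nat"
begin

(* The homogeneous coordinates are indexed by a finite type 'n, so the ambient projective
   space has dimension n = CARD('n) - 1 and real ^ 'n is R^{n+1}.

   A projective variety over R is represented by its set of complex points, that is, by a set
   of complex lines through the origin of complex ^ 'n cut out by homogeneous polynomials with
   real coefficients.  This keeps the variety and its set of real points apart, so that
   Zariski density of the real points is a genuine condition. *)

type_synonym 'n real_mpoly = "('n \<Rightarrow>\<^sub>0 nat) \<Rightarrow>\<^sub>0 real"

definition homogeneous :: "'n::finite real_mpoly \<Rightarrow> bool" where
  "homogeneous p \<longleftrightarrow> (\<exists>d. \<forall>m \<in> Poly_Mapping.keys p. (\<Sum>i\<in>UNIV. Poly_Mapping.lookup m i) = d)"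

definition eval_mpoly :: "'n::finite real_mpoly \<Rightarrow> complex ^ 'n \<Rightarrow> complex" where
  "eval_mpoly p z = (\<Sum>m \<in> Poly_Mapping.keys p.
     complex_of_real (Poly_Mapping.lookup p m) * (\<Prod>i\<in>UNIV. (z $ i) ^ Poly_Mapping.lookup m i))"

definition proj_space :: "(complex ^ 'n::finite) set set" where
  "proj_space = {vec.span {z} | z. z \<noteq> 0}"

definition complexify :: "real ^ 'n::finite \<Rightarrow> complex ^ 'n" where
  "complexify v = (\<chi> i. complex_of_real (v $ i))"

definition real_proj_points :: "(complex ^ 'n::finite) set set" where
  "real_proj_points = {vec.span {complexify v} | v. v \<noteq> 0}"

definition proj_zeros :: "'n::finite real_mpoly set \<Rightarrow> (complex ^ 'n) set set" where
  "proj_zeros S = {L \<in> proj_space. \<forall>p\<in>S. \<forall>z\<in>L. eval_mpoly p z = 0}"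

(* The closed sets of the Zariski topology over R: the equations have real coefficients. *)
definition zariski_closed :: "(complex ^ 'n::finite) set set \<Rightarrow> bool" where
  "zariski_closed X \<longleftrightarrow> (\<exists>S. (\<forall>p\<in>S. homogeneous p) \<and> X = proj_zeros S)"

definition zariski_closure :: "(complex ^ 'n::finite) set set \<Rightarrow> (complex ^ 'n) set set" where
  "zariski_closure Y = \<Inter> {A. zariski_closed A \<and> Y \<subseteq> A}"

(* Irreducibility is over R.  It is implied by irreducibility over C and is equivalent to it
   when the real points are dense. *)
definition irreducible_variety :: "(complex ^ 'n::finite) set set \<Rightarrow> bool" where
  "irreducible_variety X \<longleftrightarrow> zariski_closed X \<and> X \<noteq> {} \<and>
     (\<forall>A B. zariski_closed A \<and> zariski_closed B \<and> X = A \<union> B \<longrightarrow> X = A \<or> X = B)"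

definition real_points_dense :: "(complex ^ 'n::finite) set set \<Rightarrow> bool" where
  "real_points_dense X \<longleftrightarrow> X = zariski_closure (X \<inter> real_proj_points)"

definition hyperplane :: "real ^ 'n::finite \<Rightarrow> (complex ^ 'n) set set" where
  "hyperplane a = {L \<in> proj_space. \<forall>z\<in>L. (\<Sum>i\<in>UNIV. complex_of_real (a $ i) * z $ i) = 0}"

definition nondegenerate :: "(complex ^ 'n::finite) set set \<Rightarrow> bool" where
  "nondegenerate X \<longleftrightarrow> \<not> (\<exists>a. a \<noteq> 0 \<and> X \<subseteq> hyperplane a)"

definition real_cone :: "(complex ^ 'n::finite) set set \<Rightarrow> (real ^ 'n) set" where
  "real_cone X = {v. v = 0 \<or> vec.span {complexify v} \<in> X}"

(* The value is \<infinity> for a vector that is not a sum of elements of the cone. *)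
definition X_rank :: "(complex ^ 'n::finite) set set \<Rightarrow> real ^ 'n \<Rightarrow> enat" where
  "X_rank X v = Inf {enat r | r.
     \<exists>x :: nat \<Rightarrow> real ^ 'n. (\<forall>i<r. x i \<in> real_cone X) \<and> v = (\<Sum>i<r. x i)}"

(* A finite supremum in enat is attained, so this is the maximum whenever the ranks are
   bounded, and \<infinity> otherwise. *)
definition max_rank :: "(complex ^ 'n::finite) set set \<Rightarrow> enat" where
  "max_rank X = (SUP v \<in> {v. v \<noteq> 0}. X_rank X v)"

definition typical_rank :: "(complex ^ 'n::finite) set set \<Rightarrow> nat \<Rightarrow> bool" where
  "typical_rank X r \<longleftrightarrow> (\<exists>U. open U \<and> U \<noteq> {} \<and> U \<subseteq> {v. X_rank X v = enat r})"

definition is_min_typical_rank :: "(complex ^ 'n::finite) set set \<Rightarrow> nat \<Rightarrow> bool" where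
  "is_min_typical_rank X r \<longleftrightarrow> typical_rank X r \<and> (\<forall>s. typical_rank X s \<longrightarrow> r \<le> s)"

end

(* Let U be a nonempty open set of vectors of rank r0 and u a point of U.  Given v, the vector
   u + e v lies in U for small e > 0, so v = (u + e v) / e - u / e is a sum of two vectors of
   rank r0, because the rank is invariant under nonzero real scaling. *)

theory Submission
  imports Defs
begin

lemma complexify_scaleR: "complexify (c *\<^sub>R v) = complex_of_real c *s complexify v"
  by (simp add: complexify_def vec_eq_iff)

lemma span_singleton_scale:
  fixes z :: "'a::field ^ 'n"
  assumes "c \<noteq> 0"
  shows "vec.span {c *s z} = vec.span {z}"
  using vec.span_image_scale[of "{z}" "\<lambda>_. c"] assms by simp

text \<open>A nonzero factor leaves the complex line spanned by \<open>complexify v\<close>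
  unchanged, and for \<open>c = 0\<close> the result is the origin, which the cone contains by
  definition.\<close>

lemma real_cone_scaleR:
  assumes "v \<in> real_cone X"
  shows "c *\<^sub>R v \<in> real_cone X"
proof (cases "c = 0")
  case False
  then show ?thesis
    using assms by (auto simp: real_cone_def complexify_scaleR span_singleton_scale)
qed (simp add: real_cone_def)

lemma X_rank_le:
  assumes "\<And>i. i < r \<Longrightarrow> x i \<in> real_cone X" and "v = (\<Sum>i<r. x i)"
  shows "X_rank X v \<le> enat r"
  unfolding X_rank_def using assms by (intro Inf_lower) blast

text \<open>A finite rank is attained: \<open>enat\<close> is well-ordered, so the infimum of a
  nonempty set belongs to it.\<close>

lemma X_rank_eqE:
  assumes "X_rank X v = enat r"
  obtains x where "\<And>i. i < r \<Longrightarrow> x i \<in> real_cone X" and "v = (\<Sum>i<r. x i)"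
proof -
  let ?A = "{enat r | r. \<exists>x :: nat \<Rightarrow> _. (\<forall>i<r. x i \<in> real_cone X) \<and> v = (\<Sum>i<r. x i)}"
  have Inf: "Inf ?A = enat r"
    using assms by (simp only: X_rank_def)
  \<comment> \<open>The infimum of the empty set is \<infinity>, which differs from
    \<open>enat r\<close>.\<close>
  then have "?A \<noteq> {}"
    by (intro notI) (simp only: Inf_enat_def, simp)
  then obtain k where "k \<in> ?A"
    by (meson equals0I)
  then have "Inf ?A \<in> ?A"
    by (rule wellorder_InfI)
  then have "enat r \<in> ?A"
    by (simp only: Inf)
  then show thesis
    using that by blast
qed

text \<open>Scaling each summand of a shortest decomposition works for every \<open>c\<close>, zero
  included; equality would require \<open>c\<close> or \<open>v\<close> to be nonzero.\<close>

lemma X_rank_scaleR_le: "X_rank X (c *\<^sub>R v) \<le> X_rank X v"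
proof (cases "X_rank X v")
  case (enat r)
  obtain x where "\<And>i. i < r \<Longrightarrow> x i \<in> real_cone X" and "v = (\<Sum>i<r. x i)"
    using X_rank_eqE[OF enat] by blast
  then have "X_rank X (c *\<^sub>R v) \<le> enat r"
    by (intro X_rank_le[of r "\<lambda>i. c *\<^sub>R x i"]) (auto simp: real_cone_scaleR scaleR_sum_right)
  then show ?thesis
    by (simp add: enat)
qed simp

text \<open>Two decompositions of finite length are concatenated; if either rank is \<infinity>, the
  bound is trivial.\<close>

lemma X_rank_add_le: "X_rank X (v + w) \<le> X_rank X v + X_rank X w"
proof (cases "X_rank X v = \<infinity> \<or> X_rank X w = \<infinity>")
  case False
  then obtain r s where r: "X_rank X v = enat r" and s: "X_rank X w = enat s"
    by auto
  obtain x where x: "\<And>i. i < r \<Longrightarrow> x i \<in> real_cone X" "v = (\<Sum>i<r. x i)"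
    using X_rank_eqE[OF r] by blast
  obtain y where y: "\<And>i. i < s \<Longrightarrow> y i \<in> real_cone X" "w = (\<Sum>i<s. y i)"
    using X_rank_eqE[OF s] by blast
  define z where "z i = (if i < r then x i else y (i - r))" for i
  \<comment> \<open>A general \<open>k\<close> in place of \<open>s\<close> lets the induction
    append the terms of \<open>y\<close> one at a time.\<close>
  have "(\<Sum>i<r + k. z i) = (\<Sum>i<r. x i) + (\<Sum>i<k. y i)" for k
    by (induction k) (simp_all add: z_def add.assoc)
  then have "v + w = (\<Sum>i<r + s. z i)"
    using x y by simp
  moreover have "z i \<in> real_cone X" if "i < r + s" for i
    using x y that by (simp add: z_def)
  ultimately have "X_rank X (v + w) \<le> enat (r + s)"
    by (intro X_rank_le) auto
  then show ?thesis
    by (simp add: r s)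
qed auto

lemma X_rank_le_twice_typical_rank:
  assumes "typical_rank X r"
  shows "X_rank X v \<le> 2 * enat r"
proof -
  obtain U u where U: "open U" "u \<in> U" "\<And>x. x \<in> U \<Longrightarrow> X_rank X x = enat r"
    using assms unfolding typical_rank_def by blast
  \<comment> \<open>The one-sided filter supplies \<open>e > 0\<close> along with membership in
    \<open>U\<close>, so that dividing by \<open>e\<close> is legitimate.\<close>
  have "((\<lambda>e. u + e *\<^sub>R v) \<longlongrightarrow> u + 0 *\<^sub>R v) (at_right (0::real))"
    by (intro tendsto_intros)
  then have "\<forall>\<^sub>F e in at_right (0::real). u + e *\<^sub>R v \<in> U"
    using U by (auto intro: topological_tendstoD)
  then have "\<forall>\<^sub>F e in at_right (0::real). u + e *\<^sub>R v \<in> U \<and> e > 0"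
    by (intro eventually_conj eventually_at_right_less)
  then obtain e :: real where e: "u + e *\<^sub>R v \<in> U" "e > 0"
    using eventually_happens' trivial_limit_at_right_real by blast
  have v: "v = (1 / e) *\<^sub>R (u + e *\<^sub>R v) + (- 1 / e) *\<^sub>R u"
    using e by (simp add: scaleR_add_right)
  have "X_rank X v \<le> X_rank X ((1 / e) *\<^sub>R (u + e *\<^sub>R v)) + X_rank X ((- 1 / e) *\<^sub>R u)"
    by (subst v) (rule X_rank_add_le)
  also have "\<dots> \<le> X_rank X (u + e *\<^sub>R v) + X_rank X u"
    by (intro add_mono X_rank_scaleR_le)
  \<comment> \<open>Both \<open>u\<close> and \<open>u + e *\<^sub>R v\<close> lie in
    \<open>U\<close>, where the rank is exactly \<open>r\<close>.\<close>
  also have "\<dots> = 2 * enat r"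
    using U e by (simp add: mult_2)
  finally show ?thesis .
qed

theorem theorem3:
  fixes X :: "(complex ^ 'n::finite) set set" and r0 :: nat
  assumes "irreducible_variety X"
    and "nondegenerate X"
    and "real_points_dense X"
    and "is_min_typical_rank X r0"
  shows "max_rank X \<le> 2 * enat r0"
  using assms(4) unfolding max_rank_def is_min_typical_rank_def
  by (intro SUP_least X_rank_le_twice_typical_rank) simp

end
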